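(* Let $\mathscr{B}\subset\mathbb{N}\setminus\{1\}$ be an infinite primitive set that does not contain an infinite pairwise coprime subset. Then $\mathrm{Aut}(\{0,1\}^{\mathbb{Z}})$ embeds into $\mathrm{Aut}(\widetilde{X_{\eta_{\mathscr{B}}}})$, i.e. there exists an injective group homomorphism $\mathrm{Aut}(\{0,1\}^{\mathbb{Z}})\to \mathrm{Aut}(\widetilde{X_{\eta_{\mathscr{B}}}})$.
   Context: $\mathbb{N}=\{1,2,\ldots\}$. A set $\mathscr{B}\subset\mathbb{N}$ is primitive if $b\nmid b'$ for all distinct $b,b'\in\mathscr{B}$. A subshift is a closed subset $X\subseteq\{0,1\}^{\mathbb{Z}}$ (product topology) invariant under the left shift $\sigma$, $(\sigma x)[n]=x[n+1]$. $\mathrm{Aut}(X)$ is the group, under composition, of all homeomorphisms $X\to X$ commuting with $\sigma$. For $\mathscr{B}\subset\mathbb{N}$ let $\mathcal{M}_{\mathscr{B}}=\bigcup_{b\in\mathscr{B}}b\mathbb{Z}$, $\mathcal{F}_{\mathscr{B}}=\mathbb{Z}\setminus\mathcal{M}_{\mathscr{B}}$ and let $\eta_{\mathscr{B}}\in\{0,1\}^{\mathbb{Z}}$ be the characteristic function of $\mathcal{F}_{\mathscr{B}}$. The $\mathscr{B}$-free subshift $X_{\eta_{\mathscr{B}}}$ is the orbit closure $\overline{\{\sigma^n\eta_{\mathscr{B}}:n\in\mathbb{Z}\}}$. The hereditary closure of a subshift $X$ is $\widetilde{X}=\{y\in\{0,1\}^{\mathbb{Z}}:\exists x\in X,\ y\preccurlyeq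 x\}$, where $\preccurlyeq$ means coordinatewise less than or equal to. *)

theory Defs
  imports "HOL-Analysis.Analysis" "HOL-Algebra.Bij"
begin

text \<open>
  The full shift $\{0,1\}^{\mathbb Z}$ is the type \<^typ>\<open>int \<Rightarrow> bool\<close>, with \<^const>\<open>False\<close> for $0$
  and \<^const>\<open>True\<close> for $1$. Its topology is the library's product of the discrete topologies
  on \<^typ>\<open>bool\<close>, and its order \<open>\<le>\<close> is the coordinatewise one.
\<close>

type_synonym config = "int \<Rightarrow> bool"

definition shift :: "config \<Rightarrow> config" where
  "shift x = (\<lambda>n. x (n + 1))"

definition shift_power :: "int \<Rightarrow> config \<Rightarrow> config" where
  "shift_power n x = (\<lambda>k. x (k + n))"

lemma shift_power_of_nat: "shift_power (int n) = shift ^^ n"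
proof (induction n)
  case 0
  show ?case by (rule ext) (simp add: shift_power_def)
next
  case (Suc n)
  have "shift_power (int (Suc n)) x = shift (shift_power (int n) x)" for x
    unfolding shift_power_def shift_def by (rule ext) (simp add: add.commute add.left_commute)
  then show ?case
    by (intro ext) (simp only: Suc funpow.simps comp_apply)
qed

lemma shift_power_add: "shift_power (m + n) = shift_power m \<circ> shift_power n"
  by (intro ext) (simp add: shift_power_def add.assoc)

definition subshift :: "config set \<Rightarrow> bool" where
  "subshift X \<longleftrightarrow> closed X \<and> shift ` X = X"

text \<open>
  As for \<^const>\<open>BijGroup\<close>, the elements are extensional functions, so that each self-map of \<open>X\<close>
  is represented exactly once.
\<close>

definition shift_Aut :: "config set \<Rightarrow> (config \<Rightarrow> config) monoid" where
  "shift_Aut X = BijGroup X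
     \<lparr>carrier := {f \<in> Bij X. (\<exists>g. homeomorphism X X f g) \<and> (\<forall>x\<in>X. f (shift x) = shift (f x))}\<rparr>"

definition primitive_set :: "nat set \<Rightarrow> bool" where
  "primitive_set B \<longleftrightarrow> pairwise (\<lambda>b b'. \<not> b dvd b') B"

definition multiples :: "nat set \<Rightarrow> int set" where
  "multiples B = (\<Union>b\<in>B. range (\<lambda>k. int b * k))"

definition free_ints :: "nat set \<Rightarrow> int set" where
  "free_ints B = - multiples B"

definition eta :: "nat set \<Rightarrow> config" where
  "eta B = (\<lambda>n. n \<in> free_ints B)"

definition orbit_closure :: "config \<Rightarrow> config set" where
  "orbit_closure x = closure (range (\<lambda>n. shift_power n x))"

definition hereditary_closure :: "config set \<Rightarrow> config set" where
  "hereditary_closure X = {y. \<exists>x\<in>X. y \<le> x}"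

lemma continuous_on_shift_power: "continuous_on A (shift_power n)"
  unfolding shift_power_def
  by (rule continuous_on_coordinatewise_then_product,
      rule continuous_on_subset[OF continuous_on_product_coordinates subset_UNIV])

lemma shift_eq_shift_power: "shift = shift_power 1"
  unfolding shift_def shift_power_def by (rule refl)

lemma shift_power_inverse: "shift_power n (shift_power (- n) x) = x"
  by (simp add: shift_power_def)

lemma subshift_UNIV: "subshift UNIV"
proof -
  have "surj (shift_power 1)"
    by (rule surjI) (rule shift_power_inverse)
  then show ?thesis
    unfolding subshift_def shift_eq_shift_power by (intro conjI closed_UNIV)
qed

lemma subshift_orbit_closure: "subshift (orbit_closure x)"
proof -
  have sub: "shift_power m ` orbit_closure x \<subseteq> orbit_closure x" for m
    unfolding orbit_closure_def
  proof (rule image_closure_subset)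
    show "shift_power m ` range (\<lambda>n. shift_power n x) \<subseteq> closure (range (\<lambda>n. shift_power n x))"
    proof (rule subset_trans[OF _ closure_subset], clarify)
      fix n
      show "shift_power m (shift_power n x) \<in> range (\<lambda>n. shift_power n x)"
        by (rule range_eqI[of _ _ "m + n"]) (simp only: shift_power_add comp_apply)
    qed
  qed (rule continuous_on_shift_power closed_closure)+
  have "orbit_closure x \<subseteq> shift_power 1 ` orbit_closure x"
  proof
    fix y assume "y \<in> orbit_closure x"
    then have "shift_power (- 1) y \<in> orbit_closure x" using sub by blast
    then show "y \<in> shift_power 1 ` orbit_closure x"
      by (rule rev_image_eqI) (simp only: shift_power_inverse)
  qed
  with sub[of 1] have "shift_power 1 ` orbit_closure x = orbit_closure x"
    by (rule subset_antisym)
  moreover have "closed (orbit_closure x)"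
    unfolding orbit_closure_def by (rule closed_closure)
  ultimately show ?thesis
    by (simp only: subshift_def shift_eq_shift_power)
qed

lemma compact_UNIV_config: "compact (UNIV :: config set)"
proof -
  have "compact_space (euclidean :: bool topology)"
    unfolding compact_space_def topspace_euclidean compactin_euclidean_iff
    by (rule finite_imp_compact) (rule finite)
  then have "compact_space (product_topology (\<lambda>_::int. euclidean :: bool topology) UNIV)"
    unfolding compact_space_product_topology by blast
  then show ?thesis
    unfolding euclidean_product_topology compact_space_def topspace_euclidean
      compactin_euclidean_iff .
qed

lemma closed_config_if_compact:
  fixes X :: "config set"
  assumes "compact X"
  shows "closed X"
proof -
  have "Hausdorff_space (euclidean :: bool topology)"
    unfolding Hausdorff_space_def disjnt_def using separation_t2[where ?'a = bool] by simp
  then have "Hausdorff_space (product_topology (\<lambda>_::int. euclidean :: bool topology) UNIV)"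
    unfolding Hausdorff_space_product_topology by blast
  then have "Hausdorff_space (euclidean :: config topology)"
    unfolding euclidean_product_topology .
  moreover have "compactin euclidean X"
    using assms unfolding compactin_euclidean_iff .
  ultimately show ?thesis
    unfolding closed_closedin by (rule compactin_imp_closedin)
qed

lemma closed_hereditary_closure:
  assumes "closed X"
  shows "closed (hereditary_closure X)"
proof -
  define S where "S = {p :: config \<times> config. snd p \<le> fst p} \<inter> X \<times> UNIV"
  have "closed {p :: config \<times> config. snd p i \<le> fst p i}" for i
    by (rule closed_Collect_le[OF
          continuous_on_product_then_coordinatewise[OF continuous_on_snd[OF continuous_on_id]]
          continuous_on_product_then_coordinatewise[OF continuous_on_fst[OF continuous_on_id]]])
  then have "closed {p :: config \<times> config. snd p \<le> fst p}"
    unfolding le_fun_def by (rule closed_Collect_all)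
  then have "closed S"
    unfolding S_def by (rule closed_Int[OF _ closed_Times[OF assms closed_UNIV]])
  moreover have "compact (UNIV :: (config \<times> config) set)"
    using compact_Times[OF compact_UNIV_config compact_UNIV_config]
    by (simp only: UNIV_Times_UNIV)
  ultimately have "compact S"
    using closed_Int_compact[of S UNIV] by (simp only: Int_UNIV_right)
  moreover have "continuous_on S snd"
    by (rule continuous_on_snd[OF continuous_on_id])
  ultimately have "compact (snd ` S)"
    by (rule compact_continuous_image[rotated])
  moreover have "snd ` S = hereditary_closure X"
  proof (rule subset_antisym; rule subsetI)
    fix y assume "y \<in> snd ` S"
    then obtain p where "p \<in> S" "y = snd p" by (rule imageE)
    then have "fst p \<in> X" "y \<le> fst p"
      by (simp_all only: S_def Int_iff mem_Collect_eq mem_Times_iff)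
    then show "y \<in> hereditary_closure X"
      unfolding hereditary_closure_def by blast
  next
    fix y assume "y \<in> hereditary_closure X"
    then obtain x where "x \<in> X" "y \<le> x"
      unfolding hereditary_closure_def by blast
    then have "(x, y) \<in> S"
      by (simp only: S_def Int_iff mem_Collect_eq mem_Times_iff fst_conv snd_conv UNIV_I simp_thms)
    then show "y \<in> snd ` S"
      by (rule rev_image_eqI) (simp only: snd_conv)
  qed
  ultimately show ?thesis
    by (simp only: closed_config_if_compact)
qed

lemma subshift_hereditary_closure:
  assumes "subshift X"
  shows "subshift (hereditary_closure X)"
proof -
  have "closed (hereditary_closure X)" and invX: "shift ` X = X"
    using assms by (auto simp: subshift_def closed_hereditary_closure)
  moreover have "shift ` hereditary_closure X = hereditary_closure X"
  proof (intro equalityI subsetI)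
    fix y assume "y \<in> shift ` hereditary_closure X"
    then obtain z x where "y = shift z" "z \<le> x" "x \<in> X"
      by (auto simp: hereditary_closure_def)
    then have "y \<le> shift x" "shift x \<in> X"
      using invX by (auto simp: shift_def le_fun_def)
    then show "y \<in> hereditary_closure X"
      by (auto simp: hereditary_closure_def)
  next
    fix y assume "y \<in> hereditary_closure X"
    then obtain x' where "y \<le> x'" "x' \<in> X"
      by (auto simp: hereditary_closure_def)
    moreover from this obtain x where "x \<in> X" "x' = shift x"
      using invX by blast
    ultimately have "y \<le> shift x" by simp
    have "shift_power (- 1) y k \<le> x k" for k
      using le_funD[OF \<open>y \<le> shift x\<close>, of "k - 1"] by (simp add: shift_def shift_power_def)
    then have "shift_power (- 1) y \<le> x" by (rule le_funI)
    then have "shift_power (- 1) y \<in> hereditary_closure X"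
      using \<open>x \<in> X\<close> by (auto simp: hereditary_closure_def)
    then show "y \<in> shift ` hereditary_closure X"
      unfolding shift_eq_shift_power by (rule rev_image_eqI) (simp add: shift_power_inverse)
  qed
  ultimately show ?thesis by (simp add: subshift_def)
qed

lemma group_shift_Aut:
  assumes "subshift X"
  shows "group (shift_Aut X)"
proof -
  let ?A = "{f \<in> Bij X. (\<exists>g. homeomorphism X X f g) \<and> (\<forall>x\<in>X. f (shift x) = shift (f x))}"
  have inv: "shift x \<in> X" if "x \<in> X" for x
    using assms that by (auto simp: subshift_def)
  have "subgroup ?A (BijGroup X)"
  proof (rule subgroup.intro)
    show "?A \<subseteq> carrier (BijGroup X)" by (auto simp: BijGroup_def)
  next
    have "homeomorphism X X (\<lambda>x\<in>X. x) (\<lambda>x\<in>X. x)"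
      by (simp add: homeomorphism_def cong: continuous_on_cong)
    then show "\<one>\<^bsub>BijGroup X\<^esub> \<in> ?A"
      using inv by (auto simp: BijGroup_def id_Bij)
  next
    fix f g assume f: "f \<in> ?A" and g: "g \<in> ?A"
    then obtain f' g' where "homeomorphism X X f f'" "homeomorphism X X g g'" by auto
    then have "homeomorphism X X (f \<circ> g) (g' \<circ> f')"
      by (metis homeomorphism_compose)
    then have "homeomorphism X X (compose X f g) (g' \<circ> f')"
      by (rule homeomorphism_cong) (auto simp: compose_def)
    moreover have "g x \<in> X" if "x \<in> X" for x
      using g that Bij_imp_funcset by fastforce
    ultimately show "f \<otimes>\<^bsub>BijGroup X\<^esub> g \<in> ?A"
      using f g inv by (auto simp: BijGroup_def compose_Bij compose_eq)
  next
    fix f assume f: "f \<in> ?A"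
    then obtain g where g: "homeomorphism X X f g" by auto
    have eq: "inv_into X f x = g x" if "x \<in> X" for x
    proof (rule inv_into_f_eq)
      show "inj_on f X" using f by (simp add: Bij_def bij_betw_def)
    qed (use g that in \<open>auto simp: homeomorphism_def\<close>)
    have "homeomorphism X X g f"
      using g by (simp add: homeomorphism_symD)
    then have "homeomorphism X X (\<lambda>x\<in>X. inv_into X f x) f"
      by (rule homeomorphism_cong) (auto simp: eq)
    moreover have "g (shift x) = shift (g x)" if "x \<in> X" for x
    proof -
      have "g x \<in> X" and fg: "f (g x) = x" and gf: "\<And>y. y \<in> X \<Longrightarrow> g (f y) = y"
        using g that by (auto simp: homeomorphism_def)
      then have "f (shift (g x)) = shift x" using f by auto
      then show ?thesis using gf[of "shift (g x)"] inv \<open>g x \<in> X\<close> by simp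
    qed
    ultimately show "inv\<^bsub>BijGroup X\<^esub> f \<in> ?A"
      using f inv by (auto simp: inv_BijGroup restrict_inv_into_Bij eq)
  qed
  from group.subgroup_imp_group[OF group_BijGroup this]
  show ?thesis by (simp add: shift_Aut_def)
qed

end

theory Submission
  imports Defs "HOL-Number_Theory.Cong"
begin

text \<open>
  The hypothesis on \<open>B\<close> makes \<open>\<eta>\<close> equal to one on a whole residue class. Take a maximal pairwise
  coprime \<open>C \<subseteq> B\<close>; it is finite, and every \<open>b \<in> B\<close> shares a factor with \<open>P = \<Prod>C\<close>, so no
  \<open>1 + m P\<close> is a multiple of an element of \<open>B\<close> (\<open>free_class_exists\<close>). Moreover the classes modulo
  \<open>P\<close> contained in the free integers can be recognised in a bounded window: there is \<open>K\<close> such that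
  \<open>K\<close> consecutive terms of a progression with difference \<open>P\<close> can all be free only if the
  whole progression is (\<open>progression_dichotomy\<close>). This passes to every \<open>x\<close> in the orbit closure
  (\<open>progression_orbit_closure\<close>), and gives freedom in the hereditary closure: if \<open>y \<le> x\<close> has ones
  at \<open>K\<close> consecutive places of a class \<open>n + P\<int>\<close>, then \<open>x\<close> is one on the whole class, so
  \<open>y\<close> may be changed on that class at will and stays below \<open>x\<close>.

  It remains to let each automorphism \<open>\<phi>\<close> of the full shift act on \<open>{0,1}\<^sup>\<int>\<close> in such a
  way that points without \<open>K\<close> consecutive ones are fixed; this map, applied to the restriction of
  \<open>y\<close> to each class modulo \<open>P\<close>, preserves the hereditary closure. The action is a conveyor belt
  construction. A block is a word \<open>1\<^sup>K 0 a 0 b 0\<close>; for \<open>K \<ge> 2\<close> blocks never overlap, and changing the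
  bits \<open>a, b\<close> neither creates nor destroys a block. In a maximal run of adjacent blocks, the bits
  \<open>a\<close> are read to the right and the bits \<open>b\<close> back to the left, turning around at the ends of the
  run. Seen from any of these cells, the belt is a (possibly periodic) point of \<open>{0,1}\<^sup>\<int>\<close>, and
  the new content of the cell is coordinate zero of its image under \<open>\<phi>\<close>. Since \<open>\<phi>\<close> commutes with
  the shift, the new belt is the image of the old one under \<open>\<phi>\<close> (\<open>track_belt_map\<close>), so composition
  is respected; a bi-infinite run carries an arbitrary point on its upper track, so the action is
  faithful (\<open>belt_map_faithful\<close>).
\<close>

section \<open>Integer iterates of a bijection\<close>

definition int_iterate :: "('a \<Rightarrow> 'a) \<Rightarrow> int \<Rightarrow> 'a \<Rightarrow> 'a" where
  "int_iterate f n = (if 0 \<le> n then f ^^ nat n else inv_into UNIV f ^^ nat (- n))"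

lemma int_iterate_0 [simp]: "int_iterate f 0 x = x"
  by (simp add: int_iterate_def)

lemma int_iterate_plus_one:
  assumes "bij f"
  shows "int_iterate f (n + 1) x = f (int_iterate f n x)"
proof -
  consider "0 \<le> n" | "n = -1" | "n < -1" by linarith
  then show ?thesis
  proof cases
    case 1
    then have "nat (n + 1) = Suc (nat n)" by simp
    with 1 show ?thesis by (simp add: int_iterate_def)
  next
    case 2
    with assms show ?thesis by (simp add: int_iterate_def bij_is_surj surj_f_inv_f)
  next
    case 3
    then have "nat (- n) = Suc (nat (- (n + 1)))" by simp
    with 3 assms show ?thesis by (simp add: int_iterate_def bij_is_surj surj_f_inv_f)
  qed
qed

lemma int_iterate_unique:
  assumes "bij f" "h 0 = x" "\<And>n. h (n + 1) = f (h n)"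
  shows "int_iterate f n x = h n"
proof (induction n rule: int_induct[where k = 0])
  case base
  with assms show ?case by simp
next
  case (step1 i)
  with assms show ?case by (simp add: int_iterate_plus_one)
next
  case (step2 i)
  have "f (int_iterate f (i - 1) x) = f (h (i - 1))"
    using step2 assms(3)[of "i - 1"] int_iterate_plus_one[OF assms(1), of "i - 1" x] by simp
  with assms(1) show ?case by (simp add: bij_is_inj inj_eq)
qed

lemma int_iterate_add:
  assumes "bij f"
  shows "int_iterate f (m + n) x = int_iterate f m (int_iterate f n x)"
proof -
  have "int_iterate f m (int_iterate f n x) = (\<lambda>m. int_iterate f (m + n) x) m"
  proof (rule int_iterate_unique[OF assms])
    fix m
    show "int_iterate f (m + 1 + n) x = f (int_iterate f (m + n) x)"
      using int_iterate_plus_one[OF assms, of "m + n" x] by (simp add: algebra_simps)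
  qed simp
  then show ?thesis by simp
qed

lemma int_iterate_semiconj:
  assumes "bij f" "bij g" "\<And>x. T (f x) = g (T x)"
  shows "int_iterate g n (T x) = T (int_iterate f n x)"
  by (rule int_iterate_unique[OF assms(2)]) (simp_all add: int_iterate_plus_one assms)

lemma int_iterate_invariant:
  assumes "bij f" "\<And>x. S (f x) = S x"
  shows "S (int_iterate f n x) = S x"
proof (induction n rule: int_induct[where k = 0])
  case (step2 i)
  then show ?case
    using assms int_iterate_plus_one[OF assms(1), of "i - 1" x] by (metis diff_add_cancel)
qed (simp_all add: int_iterate_plus_one assms)

text \<open>
  The iterate at time \<open>n\<close> of one point involves only finitely many values of the map, also for
  negative \<open>n\<close>. This will make the belt seen from a cell depend continuously on the configuration.
\<close>

lemma eventually_int_iterate_eq: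
  fixes f :: "'b \<Rightarrow> 'a \<Rightarrow> 'a"
  assumes bij: "\<And>v. bij (f v)" and ev: "\<And>x. \<forall>\<^sub>F v in F. f v x = f w x"
  shows "\<forall>\<^sub>F v in F. int_iterate (f v) n x = int_iterate (f w) n x"
proof (induction n rule: int_induct[where k = 0])
  case base
  show ?case by simp
next
  case (step1 i)
  from step1(2) ev[of "int_iterate (f w) i x"] show ?case
    by eventually_elim (simp add: int_iterate_plus_one bij)
next
  case (step2 i)
  from step2(2) ev[of "int_iterate (f w) (i - 1) x"] show ?case
  proof eventually_elim
    case (elim v)
    have "f v (int_iterate (f v) (i - 1) x) = f v (int_iterate (f w) (i - 1) x)"
      using elim int_iterate_plus_one[OF bij, of v "i - 1" x]
        int_iterate_plus_one[OF bij, of w "i - 1" x] by simp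
    then show ?case using bij[of v] by (simp add: bij_is_inj inj_eq)
  qed
qed

section \<open>Shift-commuting and continuous maps\<close>

lemma shift_power_commute:
  assumes "\<And>x. \<phi> (shift x) = shift (\<phi> x)"
  shows "\<phi> (shift_power n x) = shift_power n (\<phi> x)"
proof -
  have bij: "bij shift"
    by (rule o_bij[of "shift_power (- 1)"])
      (simp_all add: fun_eq_iff shift_eq_shift_power shift_power_def)
  have "int_iterate shift n x = shift_power n x" for x
    by (rule int_iterate_unique[OF bij]) (auto simp: shift_power_def shift_def algebra_simps)
  with int_iterate_semiconj[OF bij bij, of \<phi>] assms show ?thesis by metis
qed

lemma continuous_on_bool_iff:
  fixes g :: "'a :: topological_space \<Rightarrow> bool"
  shows "continuous_on UNIV g \<longleftrightarrow> (\<forall>w. \<forall>\<^sub>F v in nhds w. g v = g w)"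
proof -
  have "(\<forall>\<^sub>F v in at w. g v = g w) \<longleftrightarrow> (\<forall>\<^sub>F v in nhds w. g v = g w)" for w
    unfolding eventually_at_filter by (intro arg_cong[where f = "\<lambda>P. eventually P (nhds w)"] ext) auto
  then show ?thesis
    by (simp only: continuous_on_def tendsto_discrete UNIV_I ball_simps simp_thms ball_UNIV)
qed

lemma continuous_on_config_iff:
  fixes f :: "config \<Rightarrow> config"
  shows "continuous_on UNIV f \<longleftrightarrow> (\<forall>w n. \<forall>\<^sub>F v in nhds w. f v n = f w n)"
proof -
  have "continuous_on UNIV f \<longleftrightarrow> (\<forall>n. continuous_on UNIV (\<lambda>v. f v n))"
    by (metis continuous_on_coordinatewise_then_product continuous_on_product_then_coordinatewise)
  then show ?thesis unfolding continuous_on_bool_iff by blast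
qed

lemma eventually_nhds_coordinate: "\<forall>\<^sub>F v in nhds w. v n = (w::config) n"
  using continuous_on_config_iff[of id] continuous_on_id by (auto simp: id_def)

section \<open>Blocks and conveyor belts\<close>

definition block_at :: "int \<Rightarrow> config \<Rightarrow> int \<Rightarrow> bool" where
  "block_at K w i \<longleftrightarrow>
     (\<forall>j\<in>{0..<K}. w (i + j)) \<and> \<not> w (i + K) \<and> \<not> w (i + K + 2) \<and> \<not> w (i + K + 4)"

definition cell_pos :: "int \<Rightarrow> int \<times> bool \<Rightarrow> int" where
  "cell_pos K c = fst c + K + (if snd c then 1 else 3)"

text \<open>
  A cell \<open>(i, s)\<close> is a data position of a block starting at \<open>i\<close>: the bit \<open>a\<close> of the upper track if
  \<open>s\<close> holds, else the bit \<open>b\<close> of the lower track. The belt moves right on the upper track and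
  left on the lower one, and changes track where the adjacent block is missing. When \<open>i\<close> is not the
  start of a block the two tracks are interchanged; these pairs carry no data, and the convention
  makes the successor a bijection of all pairs.
\<close>

definition next_cell :: "int \<Rightarrow> config \<Rightarrow> int \<times> bool \<Rightarrow> int \<times> bool" where
  "next_cell K w = (\<lambda>(i, s). let j = (if s then i + (K + 5) else i - (K + 5))
     in if block_at K w i \<and> block_at K w j then (j, s) else (i, \<not> s))"

definition track :: "int \<Rightarrow> config \<Rightarrow> int \<times> bool \<Rightarrow> config" where
  "track K w c = (\<lambda>n. w (cell_pos K (int_iterate (next_cell K w) n c)))"

definition belt_map :: "int \<Rightarrow> (config \<Rightarrow> config) \<Rightarrow> config \<Rightarrow> config" where
  "belt_map K \<phi> w = (\<lambda>p.
     if block_at K w (p - K - 1) then \<phi> (track K w (p - K - 1, True)) 0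
     else if block_at K w (p - K - 3) then \<phi> (track K w (p - K - 3, False)) 0
     else w p)"

text \<open>
  A block starts with two adjacent ones, and in another block such a pair occurs only inside its
  prefix \<open>1\<^sup>K\<close>, whose terminating zero would fall into the prefix of a later block starting there.
\<close>

lemma block_at_disjoint:
  assumes "2 \<le> K" "block_at K w i" "block_at K w i'" "i < i'"
  shows "i + (K + 5) \<le> i'"
proof (rule ccontr)
  assume "\<not> ?thesis"
  moreover have "w (i' + j)" if "0 \<le> j" "j < K" for j
    using assms(3) that by (auto simp: block_at_def)
  from this[of "i + K - i'"] this[of 0] this[of 1] have
    "i' \<le> i + K \<Longrightarrow> w (i + K)" "w i'" "w (i' + 1)" using assms(1,4) by auto
  moreover have "\<not> w (i + K)" "\<not> w (i + K + 2)" "\<not> w (i + K + 4)"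
    using assms(2) by (auto simp: block_at_def)
  moreover have "i' \<le> i + K \<or> i' = i + K + 2 \<or> i' = i + K + 4 \<or> i' + 1 = i + K + 2 \<or> i' + 1 = i + K + 4"
    using calculation(1) by linarith
  ultimately show False by metis
qed

text \<open>
  Since blocks are disjoint, a change of cells leaves the fixed part of every block intact. A new
  block would need a changed position in its fixed part, hence would overlap an old block, which is
  still a block after the change; this contradicts disjointness.
\<close>

lemma block_at_change_cells:
  assumes K: "2 \<le> K"
    and change: "\<And>p. v p \<noteq> w p \<Longrightarrow> \<exists>c. block_at K w (fst c) \<and> p = cell_pos K c"
  shows "block_at K v i \<longleftrightarrow> block_at K w i"
proof
  have keep: "v (i + d) = w (i + d)"
    if "block_at K w i" "d \<in> {0..<K} \<union> {K, K + 2, K + 4}" for i d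
  proof (rule ccontr)
    assume "v (i + d) \<noteq> w (i + d)"
    then obtain c where c: "block_at K w (fst c)" "i + d = cell_pos K c"
      using change by blast
    then have "i \<noteq> fst c" using that by (auto simp: cell_pos_def split: if_splits)
    with block_at_disjoint[OF K c(1) that(1)] block_at_disjoint[OF K that(1) c(1)]
    show False using c(2) that(2) K by (auto simp: cell_pos_def split: if_splits)
  qed
  have up: "block_at K v i" if "block_at K w i" for i
    using keep[OF that] that by (simp add: block_at_def add.assoc)
  then show "block_at K w i \<Longrightarrow> block_at K v i" .
  assume i: "block_at K v i"
  show "block_at K w i"
  proof (rule ccontr)
    assume not: "\<not> block_at K w i"
    have "block_at K w i" if "\<forall>d \<in> {0..<K} \<union> {K, K + 2, K + 4}. v (i + d) = w (i + d)"
      using i that by (simp add: block_at_def add.assoc)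
    with not obtain d where d: "d \<in> {0..<K} \<union> {K, K + 2, K + 4}" "v (i + d) \<noteq> w (i + d)"
      by blast
    then obtain c where c: "block_at K w (fst c)" "i + d = cell_pos K c"
      using change by blast
    then have "i \<noteq> fst c" using not by auto
    with block_at_disjoint[OF K up[OF c(1)] i] block_at_disjoint[OF K i up[OF c(1)]]
    show False using c(2) d(1) K by (auto simp: cell_pos_def split: if_splits)
  qed
qed

lemma block_at_shift_power: "block_at K (shift_power m w) i = block_at K w (i + m)"
  by (simp add: block_at_def shift_power_def algebra_simps)

lemma bij_next_cell: "bij (next_cell K w)"
proof (rule o_bij)
  \<comment> \<open>The belt run backwards is the belt with its two tracks interchanged.\<close>
  let ?flip = "apsnd Not :: int \<times> bool \<Rightarrow> int \<times> bool"
  show "(?flip \<circ> next_cell K w \<circ> ?flip) \<circ> next_cell K w = id"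
    and "next_cell K w \<circ> (?flip \<circ> next_cell K w \<circ> ?flip) = id"
    by (auto simp: fun_eq_iff next_cell_def Let_def)
qed

lemma block_at_next_cell: "block_at K w (fst (next_cell K w c)) = block_at K w (fst c)"
  by (auto simp: next_cell_def Let_def split: prod.splits)

lemma block_at_int_iterate:
  "block_at K w (fst (int_iterate (next_cell K w) n c)) = block_at K w (fst c)"
  by (rule int_iterate_invariant[where S = "\<lambda>c. block_at K w (fst c)",
        OF bij_next_cell block_at_next_cell])

lemma track_int_iterate:
  "track K w (int_iterate (next_cell K w) n c) = shift_power n (track K w c)"
  by (simp add: track_def shift_power_def int_iterate_add[OF bij_next_cell])

lemma track_shift_power: "track K (shift_power m w) (i, s) = track K w (i + m, s)"
proof -
  let ?T = "\<lambda>c :: int \<times> bool. (fst c + m, snd c)"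
  have "?T (next_cell K (shift_power m w) c) = next_cell K w (?T c)" for c
    by (cases c) (auto simp: next_cell_def Let_def block_at_shift_power algebra_simps)
  from int_iterate_semiconj[where T = ?T, OF bij_next_cell bij_next_cell this]
  have "int_iterate (next_cell K w) n (i + m, s)
      = ?T (int_iterate (next_cell K (shift_power m w)) n (i, s))" for n
    by (metis fst_conv snd_conv)
  then show ?thesis
    by (auto simp: track_def cell_pos_def shift_power_def algebra_simps)
qed

lemma eventually_block_at_eq: "\<forall>\<^sub>F v in nhds w. block_at K v i = block_at K w i"
proof -
  have "\<forall>\<^sub>F v in nhds w. \<forall>d \<in> {i..<i + K} \<union> {i + K, i + K + 2, i + K + 4}. v d = w d"
    by (intro eventually_ball_finite) (auto intro: eventually_nhds_coordinate)
  then show ?thesis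
    by (rule eventually_mono) (simp add: block_at_def)
qed

lemma eventually_track_eq: "\<forall>\<^sub>F v in nhds w. track K v c n = track K w c n"
proof -
  have "\<forall>\<^sub>F v in nhds w. next_cell K v (i, s) = next_cell K w (i, s)" for i s
    using eventually_block_at_eq[of K i w] eventually_block_at_eq[of K "i + (K + 5)" w]
      eventually_block_at_eq[of K "i - (K + 5)" w]
    by eventually_elim (simp add: next_cell_def)
  then have "\<forall>\<^sub>F v in nhds w. int_iterate (next_cell K v) n c = int_iterate (next_cell K w) n c"
    by (intro eventually_int_iterate_eq bij_next_cell) (metis surj_pair)
  with eventually_nhds_coordinate[where w = w and n = "cell_pos K (int_iterate (next_cell K w) n c)"]
  show ?thesis by eventually_elim (simp add: track_def)
qed


lemma belt_map_cell:
  assumes "2 \<le> K" "block_at K w (fst c)"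
  shows "belt_map K \<phi> w (cell_pos K c) = \<phi> (track K w c) 0"
proof (cases c)
  case (Pair i s)
  then have "\<not> block_at K w (i + 2)"
    using assms block_at_disjoint[of K w i "i + 2"] by auto
  then show ?thesis
    using assms(2) Pair by (auto simp: belt_map_def cell_pos_def add.commute)
qed

lemma belt_map_off_cells:
  assumes "\<And>c. block_at K w (fst c) \<Longrightarrow> p \<noteq> cell_pos K c"
  shows "belt_map K \<phi> w p = w p"
  using assms[of "(p - K - 1, True)"] assms[of "(p - K - 3, False)"]
  by (auto simp: belt_map_def cell_pos_def)

lemma block_at_belt_map:
  assumes "2 \<le> K"
  shows "block_at K (belt_map K \<phi> w) i \<longleftrightarrow> block_at K w i"
  by (rule block_at_change_cells[OF assms]) (metis belt_map_off_cells)

text \<open>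
  The belt structure is unchanged, and the belt seen from the \<open>n\<close>-th successor of \<open>c\<close> is the
  \<open>n\<close>-fold shift of the belt seen from \<open>c\<close>. As \<open>\<phi>\<close> commutes with shifts, writing coordinate zero of
  the image into each cell therefore writes the whole image onto the belt.
\<close>

lemma track_belt_map:
  assumes K: "2 \<le> K" and \<phi>: "\<And>x. \<phi> (shift x) = shift (\<phi> x)" and c: "block_at K w (fst c)"
  shows "track K (belt_map K \<phi> w) c = \<phi> (track K w c)"
proof
  fix n
  let ?c = "int_iterate (next_cell K w) n c"
  have "next_cell K (belt_map K \<phi> w) = next_cell K w"
    by (auto simp: fun_eq_iff next_cell_def block_at_belt_map[OF K])
  then have "track K (belt_map K \<phi> w) c n = belt_map K \<phi> w (cell_pos K ?c)"
    by (simp add: track_def)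
  also have "\<dots> = \<phi> (track K w ?c) 0"
    using c by (intro belt_map_cell[OF K]) (simp add: block_at_int_iterate)
  also have "\<dots> = \<phi> (track K w c) n"
    by (simp add: track_int_iterate shift_power_commute[of \<phi>, OF \<phi>]) (simp add: shift_power_def)
  finally show "track K (belt_map K \<phi> w) c n = \<phi> (track K w c) n" .
qed

lemma belt_map_comp:
  assumes K: "2 \<le> K" and \<psi>: "\<And>x. \<psi> (shift x) = shift (\<psi> x)"
  shows "belt_map K \<phi> (belt_map K \<psi> w) = belt_map K (\<phi> \<circ> \<psi>) w"
proof
  fix p
  show "belt_map K \<phi> (belt_map K \<psi> w) p = belt_map K (\<phi> \<circ> \<psi>) w p"
  proof (cases "\<exists>c. block_at K w (fst c) \<and> p = cell_pos K c")
    case True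
    then show ?thesis
      by (auto simp: belt_map_cell[OF K] block_at_belt_map[OF K] track_belt_map[of K \<psi>, OF K \<psi>])
  next
    case False
    have "belt_map K \<phi> (belt_map K \<psi> w) p = belt_map K \<psi> w p"
      by (rule belt_map_off_cells) (use False in \<open>auto simp: block_at_belt_map[OF K]\<close>)
    also have "\<dots> = w p"
      by (rule belt_map_off_cells) (use False in blast)
    also have "w p = belt_map K (\<phi> \<circ> \<psi>) w p"
      by (rule belt_map_off_cells[symmetric]) (use False in blast)
    finally show ?thesis .
  qed
qed

lemma belt_map_id: "belt_map K id w = w"
  by (auto simp: belt_map_def track_def cell_pos_def fun_eq_iff)

lemma belt_map_shift: "belt_map K \<phi> (shift w) = shift (belt_map K \<phi> w)"
  unfolding shift_eq_shift_power belt_map_def block_at_shift_power track_shift_power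
  by (simp add: shift_power_def algebra_simps)

lemma belt_map_eq_self:
  assumes "\<And>i. \<exists>j\<in>{0..<K}. \<not> w (i + j)"
  shows "belt_map K \<phi> w = w"
proof -
  have "\<not> block_at K w i" for i using assms[of i] by (auto simp: block_at_def)
  then show ?thesis by (auto simp: belt_map_def)
qed

lemma continuous_on_belt_map:
  assumes "continuous_on UNIV \<phi>"
  shows "continuous_on UNIV (belt_map K \<phi>)"
  unfolding continuous_on_config_iff
proof (intro allI)
  fix w p
  have track: "continuous_on UNIV (\<lambda>v. track K v c)" for c
    unfolding continuous_on_config_iff by (simp add: eventually_track_eq)
  have "continuous_on UNIV (\<lambda>v. \<phi> (track K v c))" for c
    by (rule continuous_on_compose2[OF assms track]) simp
  then have "\<forall>\<^sub>F v in nhds w. \<phi> (track K v c) 0 = \<phi> (track K w c) 0" for c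
    unfolding continuous_on_config_iff by blast
  from this[of "(p - K - 1, True)"] this[of "(p - K - 3, False)"]
    eventually_block_at_eq[of K "p - K - 1" w] eventually_block_at_eq[of K "p - K - 3" w]
    eventually_nhds_coordinate[where w = w and n = p]
  show "\<forall>\<^sub>F v in nhds w. belt_map K \<phi> v p = belt_map K \<phi> w p"
    by eventually_elim (simp add: belt_map_def)
qed

text \<open>
  The witness is a bi-infinite run of adjacent blocks with \<open>z\<close> on the upper track and zeros on the
  lower one. It does not depend on \<open>\<phi>\<close>, so it separates any two maps that differ at \<open>z\<close> in
  coordinate zero.
\<close>

lemma belt_map_faithful:
  assumes "0 \<le> K"
  shows "\<exists>w p. \<forall>\<phi>. belt_map K \<phi> w p = \<phi> z 0"
proof -
  define w where "w = (\<lambda>p. p mod (K + 5) < K \<or> p mod (K + 5) = K + 1 \<and> z (p div (K + 5)))"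
  have w: "w (n * (K + 5) + r) \<longleftrightarrow> r < K \<or> r = K + 1 \<and> z n" if "0 \<le> r" "r < K + 5" for n r
    using that assms by (simp add: w_def)
  have block: "block_at K w (n * (K + 5))" for n
    using assms by (auto simp: block_at_def w add.assoc)
  have "int_iterate (next_cell K w) n (0, True) = (n * (K + 5), True)" for n
  proof (rule int_iterate_unique[OF bij_next_cell])
    fix n
    show "((n + 1) * (K + 5), True) = next_cell K w (n * (K + 5), True)"
      using block[of n] block[of "n + 1"] by (simp add: next_cell_def algebra_simps)
  qed simp
  then have "track K w (0, True) = z"
    using assms by (auto simp: track_def cell_pos_def add.assoc w)
  then have "belt_map K \<phi> w (K + 1) = \<phi> z 0" for \<phi>
    using block[of 0] by (simp add: belt_map_def)
  then show ?thesis by blast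
qed

section \<open>Acting on all residue classes\<close>

definition classwise :: "int \<Rightarrow> (config \<Rightarrow> config) \<Rightarrow> config \<Rightarrow> config" where
  "classwise P F y = (\<lambda>n. F (\<lambda>j. y (n + j * P)) 0)"

lemma classwise_comp:
  assumes "\<And>x. G (shift x) = shift (G x)"
  shows "classwise P F (classwise P G y) = classwise P (F \<circ> G) y"
proof
  fix n
  have "(\<lambda>k. y (n + j * P + k * P)) = shift_power j (\<lambda>k. y (n + k * P))" for j
    by (simp add: shift_power_def algebra_simps)
  then have "G (\<lambda>k. y (n + j * P + k * P)) 0 = G (\<lambda>k. y (n + k * P)) j" for j
    by (simp add: shift_power_commute[of G, OF assms]) (simp add: shift_power_def)
  then show "classwise P F (classwise P G y) n = classwise P (F \<circ> G) y n"
    by (simp add: classwise_def)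
qed

lemma classwise_shift: "classwise P F (shift y) = shift (classwise P F y)"
  by (simp add: classwise_def shift_def algebra_simps)

lemma continuous_on_classwise:
  assumes "continuous_on UNIV F"
  shows "continuous_on UNIV (classwise P F)"
proof -
  have "continuous_on UNIV (\<lambda>y :: config. (\<lambda>j. y (n + j * P)))" for n
    unfolding continuous_on_config_iff by (simp add: eventually_nhds_coordinate)
  then have "continuous_on UNIV (\<lambda>y. F (\<lambda>j. y (n + j * P)))" for n
    by (intro continuous_on_compose2[OF assms]) auto
  then show ?thesis
    unfolding continuous_on_config_iff classwise_def by blast
qed

section \<open>Arithmetic progressions in the free integers\<close>

lemma free_class_exists:
  assumes B: "B \<subseteq> {1..} - {1}"
    and no: "\<not> (\<exists>C. C \<subseteq> B \<and> infinite C \<and> pairwise coprime C)"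
  shows "\<exists>P>0. \<forall>m. 1 + m * P \<in> free_ints B"
proof -
  let ?A = "{C. C \<subseteq> B \<and> pairwise coprime C}"
  have "\<exists>C\<in>?A. \<forall>D\<in>?A. C \<subseteq> D \<longrightarrow> D = C"
  proof (rule subset_Zorn_nonempty)
    show "?A \<noteq> {}" by (auto intro!: exI[of _ "{}"])
  next
    fix \<C> assume "\<C> \<noteq> {}" "subset.chain ?A \<C>"
    then have "\<C> \<subseteq> ?A" "chain\<^sub>\<subseteq> \<C>"
      by (auto simp: subset_chain_def chain_subset_def)
    then show "\<Union>\<C> \<in> ?A"
      by (auto intro!: pairwise_chain_Union)
  qed
  then obtain C where "C \<in> ?A" and "\<forall>D\<in>?A. C \<subseteq> D \<longrightarrow> D = C"
    by (rule bexE)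
  then have C: "C \<subseteq> B" "pairwise coprime C"
    and max: "\<And>D. D \<subseteq> B \<Longrightarrow> pairwise coprime D \<Longrightarrow> C \<subseteq> D \<Longrightarrow> D = C"
    by simp_all
  have fin: "finite C" using no C by blast
  have common: "\<exists>c\<in>C. \<not> coprime b c" if b: "b \<in> B" for b
  proof (cases "b \<in> C")
    case True
    with b B show ?thesis by (auto intro!: bexI[of _ b])
  next
    case False
    then have "\<not> pairwise coprime (insert b C)"
      using max[of "insert b C"] b C(1) by blast
    with C(2) show ?thesis by (auto simp: pairwise_insert coprime_commute)
  qed
  have "1 + m * int (\<Prod>C) \<in> free_ints B" for m
  proof (rule ccontr)
    assume "1 + m * int (\<Prod>C) \<notin> free_ints B"
    then obtain b k where b: "b \<in> B" "1 + m * int (\<Prod>C) = int b * k"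
      by (auto simp: free_ints_def multiples_def)
    with common obtain c where c: "c \<in> C" "\<not> coprime b c" by blast
    have "int (gcd b c) dvd int b" "int (gcd b c) dvd int (\<Prod>C)"
      using dvd_trans[OF gcd_dvd2 dvd_prodI[OF fin c(1)], of b "\<lambda>x. x"]
      by (simp_all only: of_nat_dvd_iff gcd_dvd1)
    then have "int (gcd b c) dvd int b * k - m * int (\<Prod>C)" by (intro dvd_diff dvd_mult dvd_mult2)
    moreover have "int b * k - m * int (\<Prod>C) = 1" using b(2) by linarith
    ultimately have "int (gcd b c) dvd 1" by simp
    with c(2) show False by (simp add: coprime_iff_gcd_eq_1)
  qed
  moreover have "0 < int (\<Prod>C)"
    using B C(1) by (auto intro!: prod_pos simp: of_nat_prod)
  ultimately show ?thesis by blast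
qed

text \<open>
  A progression \<open>n + P\<int>\<close> meets the multiples of \<open>b\<close> exactly when \<open>g = gcd b P\<close> divides \<open>n\<close>, and
  then it does so within any \<open>b\<close> consecutive terms. The criterion depends on \<open>b\<close> only through \<open>g\<close>,
  which takes finitely many values, so one representative \<open>b\<close> for each value of \<open>g\<close> suffices to
  detect a multiple, and \<open>K\<close> only has to exceed these finitely many representatives.
\<close>

lemma progression_dichotomy:
  assumes B: "0 \<notin> B" and P: "0 < (P :: int)"
  shows "\<exists>K\<ge>2. \<forall>n. (\<forall>j\<in>{0..<K}. n + j * P \<in> free_ints B) \<longrightarrow> (\<forall>m. n + m * P \<in> free_ints B)"
proof -
  let ?G = "(\<lambda>b. gcd (int b) P) ` B"
  have "?G \<subseteq> {0..P}" using P by (auto intro: zdvd_imp_le)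
  then have fin: "finite ?G" by (rule finite_subset) simp
  define f where "f g = (SOME b. b \<in> B \<and> gcd (int b) P = g)" for g
  have f: "f g \<in> B" "gcd (int (f g)) P = g" if "g \<in> ?G" for g
    using that someI_ex[of "\<lambda>b. b \<in> B \<and> gcd (int b) P = g"] by (auto simp: f_def)
  \<comment> \<open>The sum is a convenient common upper bound of the representatives.\<close>
  define K where "K = 2 + (\<Sum>g\<in>?G. int (f g))"
  have "2 \<le> K" by (simp add: K_def sum_nonneg)
  moreover have "n + m * P \<in> free_ints B"
    if run: "\<forall>j\<in>{0..<K}. n + j * P \<in> free_ints B" for n m
  proof (rule ccontr)
    assume "n + m * P \<notin> free_ints B"
    then obtain b k where b: "b \<in> B" "n + m * P = int b * k"
      by (auto simp: free_ints_def multiples_def)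
    define g where "g = gcd (int b) P"
    have g: "g \<in> ?G" using b(1) by (auto simp: g_def)
    define a where "a = int (f g)"
    have "0 < a" using f(1)[OF g] B by (auto simp: a_def intro: gr0I)
    have "g dvd int b * k - m * P" by (simp add: g_def)
    then have "g dvd n" by (simp flip: b(2))
    then obtain t where t: "n = g * t" by (rule dvdE)
    obtain u v where "u * a + v * P = gcd a P" using bezout_int by blast
    then have uv: "u * a + v * P = g" using f(2)[OF g] by (simp add: a_def)
    \<comment> \<open>By the Bezout identity \<open>j = - t v\<close> solves \<open>n + j P = 0\<close> modulo \<open>a\<close>.\<close>
    define j where "j = (- t * v) mod a"
    have "[n + j * P = n + (- t * v) * P] (mod a)"
      unfolding j_def by (intro cong_add cong_mult cong_refl) simp
    also have "n + (- t * v) * P = a * (t * u)"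
      unfolding t uv[symmetric] by (simp add: algebra_simps)
    finally have "a dvd n + j * P" by (simp add: cong_dvd_iff)
    then have "n + j * P \<notin> free_ints B"
      using f(1)[OF g] by (auto simp: free_ints_def multiples_def a_def elim!: dvdE)
    moreover have "a < K"
      using member_le_sum[OF g _ fin, of "\<lambda>g. int (f g)"] by (simp add: K_def a_def)
    then have "j \<in> {0..<K}" using \<open>0 < a\<close> pos_mod_bound[of a "- t * v"] pos_mod_sign[of a "- t * v"]
      unfolding j_def atLeastLessThan_iff by linarith
    ultimately show False using run by blast
  qed
  ultimately show ?thesis by blast
qed

lemma eventually_nhds_closure:
  assumes "x \<in> closure T" "\<forall>\<^sub>F v in nhds x. Q v"
  shows "\<exists>v\<in>T. Q v"
proof -
  obtain S where "open S" "x \<in> S" "\<forall>v\<in>S. Q v"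
    using assms(2) by (auto simp: eventually_nhds)
  with assms(1) show ?thesis
    using open_Int_closure_eq_empty[of S T] by blast
qed

lemma progression_orbit_closure:
  assumes K: "\<forall>n. (\<forall>j\<in>{0..<K}. n + j * P \<in> free_ints B) \<longrightarrow> (\<forall>m. n + m * P \<in> free_ints B)"
    and x: "x \<in> orbit_closure (eta B)" and run: "\<forall>j\<in>{0..<K}. x (n + j * P)"
  shows "x (n + m * P)"
proof -
  have "\<forall>\<^sub>F v in nhds x. \<forall>j\<in>insert m {0..<K}. v (n + j * P) = x (n + j * P)"
    by (intro eventually_ball_finite) (auto intro: eventually_nhds_coordinate)
  then obtain v where v: "v \<in> range (\<lambda>i. shift_power i (eta B))"
      "\<forall>j\<in>insert m {0..<K}. v (n + j * P) = x (n + j * P)"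
    using eventually_nhds_closure x unfolding orbit_closure_def by blast
  from v(1) obtain i where i: "v k \<longleftrightarrow> k + i \<in> free_ints B" for k
    by (auto simp: shift_power_def eta_def)
  have "(n + i) + j * P \<in> free_ints B" if "j \<in> {0..<K}" for j
    using v(2) run that i[of "n + j * P"] by (auto simp: algebra_simps)
  with K have "(n + i) + m * P \<in> free_ints B" by blast
  with v(2) i[of "n + m * P"] show ?thesis by (simp add: algebra_simps)
qed

section \<open>The embedding\<close>

text \<open>
  Reduces the theorem to an action on all configurations: inverses in the automorphism group are
  obtained from the composition law, and knowing coordinate zero of \<open>\<phi> z\<close> for every \<open>z\<close> determines
  a shift-commuting \<open>\<phi>\<close>.
\<close>

lemma shift_Aut_embedding:
  fixes E :: "(config \<Rightarrow> config) \<Rightarrow> config \<Rightarrow> config"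
  assumes shiftX: "\<And>y. y \<in> X \<Longrightarrow> shift y \<in> X"
    and X: "\<And>\<phi> y. y \<in> X \<Longrightarrow> E \<phi> y \<in> X"
    and comp: "\<And>\<phi> \<psi> y. (\<And>x. \<psi> (shift x) = shift (\<psi> x)) \<Longrightarrow> E \<phi> (E \<psi> y) = E (\<phi> \<circ> \<psi>) y"
    and id: "\<And>y. E id y = y"
    and shift: "\<And>\<phi> y. E \<phi> (shift y) = shift (E \<phi> y)"
    and cont: "\<And>\<phi>. continuous_on UNIV \<phi> \<Longrightarrow> continuous_on UNIV (E \<phi>)"
    and faithful: "\<And>z. \<exists>y\<in>X. \<exists>p. \<forall>\<phi>. E \<phi> y p = \<phi> z 0"
  shows "\<exists>\<Phi>. \<Phi> \<in> hom (shift_Aut UNIV) (shift_Aut X) \<and> inj_on \<Phi> (carrier (shift_Aut UNIV))"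
proof (intro exI conjI)
  let ?\<Phi> = "\<lambda>\<phi>. restrict (E \<phi>) X"
  have carrier: "?\<Phi> \<phi> \<in> carrier (shift_Aut X)" if \<phi>: "\<phi> \<in> carrier (shift_Aut UNIV)" for \<phi>
  proof -
    obtain \<psi> where hom: "homeomorphism UNIV UNIV \<phi> \<psi>" and sh: "\<And>x. \<phi> (shift x) = shift (\<phi> x)"
      using \<phi> by (auto simp: shift_Aut_def)
    then have inv: "\<phi> \<circ> \<psi> = id" "\<psi> \<circ> \<phi> = id"
      by (auto simp: homeomorphism_def fun_eq_iff)
    have sh': "\<psi> (shift x) = shift (\<psi> x)" for x
      using inv sh[of "\<psi> x"] by (metis comp_apply id_apply)
    have E: "E \<phi> (E \<psi> y) = y" "E \<psi> (E \<phi> y) = y" for y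
      by (simp_all add: comp sh sh' inv id)
    have "homeomorphism X X (E \<phi>) (E \<psi>)"
    proof (rule homeomorphismI)
      show "continuous_on X (E \<phi>)" "continuous_on X (E \<psi>)"
        using hom cont by (auto simp: homeomorphism_def intro: continuous_on_subset)
    qed (use X E in auto)
    then have hX: "homeomorphism X X (?\<Phi> \<phi>) (E \<psi>)"
      by (rule homeomorphism_cong) auto
    have "bij_betw (E \<phi>) X X"
      by (rule bij_betw_byWitness[where f' = "E \<psi>"]) (use X E in auto)
    then have "?\<Phi> \<phi> \<in> Bij X" by (simp add: Bij_def)
    moreover have "?\<Phi> \<phi> (shift y) = shift (?\<Phi> \<phi> y)" if "y \<in> X" "shift y \<in> X" for y
      using that shift by simp
    ultimately show ?thesis using hX shiftX by (auto simp: shift_Aut_def)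
  qed
  show "?\<Phi> \<in> hom (shift_Aut UNIV) (shift_Aut X)"
  proof (rule homI)
    fix \<phi> \<psi> assume *: "\<phi> \<in> carrier (shift_Aut UNIV)" "\<psi> \<in> carrier (shift_Aut UNIV)"
    then have "?\<Phi> \<phi> \<in> Bij X" "?\<Phi> \<psi> \<in> Bij X" "\<phi> \<in> Bij UNIV" "\<psi> \<in> Bij UNIV"
      and "\<And>x. \<psi> (shift x) = shift (\<psi> x)"
      using carrier by (auto simp: shift_Aut_def)
    moreover from this have "compose X (?\<Phi> \<phi>) (?\<Phi> \<psi>) = ?\<Phi> (\<phi> \<circ> \<psi>)"
      using X comp by (auto simp: compose_def fun_eq_iff)
    moreover have "compose UNIV \<phi> \<psi> = \<phi> \<circ> \<psi>" by (simp add: compose_def fun_eq_iff)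
    ultimately show "?\<Phi> (\<phi> \<otimes>\<^bsub>shift_Aut UNIV\<^esub> \<psi>) = ?\<Phi> \<phi> \<otimes>\<^bsub>shift_Aut X\<^esub> ?\<Phi> \<psi>"
      by (simp add: shift_Aut_def BijGroup_def)
  qed (rule carrier)
  show "inj_on ?\<Phi> (carrier (shift_Aut UNIV))"
  proof (rule inj_onI)
    fix \<phi> \<psi> assume *: "\<phi> \<in> carrier (shift_Aut UNIV)" "\<psi> \<in> carrier (shift_Aut UNIV)"
      and eq: "?\<Phi> \<phi> = ?\<Phi> \<psi>"
    have sh: "\<phi> (shift x) = shift (\<phi> x)" "\<psi> (shift x) = shift (\<psi> x)" for x
      using * by (auto simp: shift_Aut_def)
    have "\<phi> z 0 = \<psi> z 0" for z
      using faithful[of z] fun_cong[OF eq] by (metis restrict_apply')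
    from this[of "shift_power n z" for n z] have "\<phi> z n = \<psi> z n" for z n
      unfolding shift_power_commute[of \<phi>, OF sh(1)] shift_power_commute[of \<psi>, OF sh(2)]
      by (simp add: shift_power_def)
    then show "\<phi> = \<psi>" by blast
  qed
qed

theorem theorem1:
  fixes B :: "nat set"
  assumes "B \<subseteq> {1..} - {1}"
    and "infinite B"
    and "primitive_set B"
    and "\<not> (\<exists>C. C \<subseteq> B \<and> infinite C \<and> pairwise coprime C)"
  shows "\<exists>\<Phi>. \<Phi> \<in> hom (shift_Aut UNIV) (shift_Aut (hereditary_closure (orbit_closure (eta B))))
            \<and> inj_on \<Phi> (carrier (shift_Aut UNIV))"
proof -
  let ?X = "orbit_closure (eta B)"
  obtain P where P: "0 < P" and free: "\<And>m. 1 + m * P \<in> free_ints B"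
    using free_class_exists assms by blast
  have "0 \<notin> B" using assms(1) by auto
  then obtain K where K: "2 \<le> K"
    and dichotomy: "\<forall>n. (\<forall>j\<in>{0..<K}. n + j * P \<in> free_ints B) \<longrightarrow> (\<forall>m. n + m * P \<in> free_ints B)"
    using progression_dichotomy P by blast
  note fill = progression_orbit_closure[OF dichotomy]
  define E where "E \<phi> = classwise P (belt_map K \<phi>)" for \<phi>
  show ?thesis
  proof (rule shift_Aut_embedding[where E = E])
    show "shift y \<in> hereditary_closure ?X" if "y \<in> hereditary_closure ?X" for y
      using that subshift_hereditary_closure[OF subshift_orbit_closure, of "eta B"]
      by (auto simp: subshift_def)
  next
    fix \<phi> y assume "y \<in> hereditary_closure ?X"
    then obtain x where x: "x \<in> ?X" "y \<le> x" by (auto simp: hereditary_closure_def)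
    \<comment> \<open>The same \<open>x\<close> dominates the image: a class is altered only if \<open>y\<close> has \<open>K\<close>
      consecutive ones on it, and then \<open>x\<close> is one throughout that class.\<close>
    have "x n" if "E \<phi> y n" for n
    proof (cases "\<exists>i. \<forall>j\<in>{0..<K}. y (n + (i + j) * P)")
      case True
      then obtain i where "\<forall>j\<in>{0..<K}. x ((n + i * P) + j * P)"
        using x(2) by (auto simp: le_fun_def algebra_simps)
      from fill[OF x(1) this, of "- i"] show ?thesis by simp
    next
      case False
      then have "E \<phi> y n = y n"
        unfolding E_def classwise_def by (subst belt_map_eq_self) auto
      with that x(2) show ?thesis by (auto simp: le_fun_def)
    qed
    then show "E \<phi> y \<in> hereditary_closure ?X"
      using x(1) by (auto simp: hereditary_closure_def le_fun_def)
  next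
    fix \<phi> \<psi> :: "config \<Rightarrow> config" and y
    assume \<psi>: "\<And>x. \<psi> (shift x) = shift (\<psi> x)"
    have "belt_map K \<phi> \<circ> belt_map K \<psi> = belt_map K (\<phi> \<circ> \<psi>)"
      using belt_map_comp[of K \<psi>, OF K \<psi>] by (auto simp: fun_eq_iff)
    then show "E \<phi> (E \<psi> y) = E (\<phi> \<circ> \<psi>) y"
      by (simp add: E_def classwise_comp belt_map_shift)
  next
    fix z
    obtain w p where wp: "\<And>\<phi>. belt_map K \<phi> w p = \<phi> z 0"
      using belt_map_faithful[of K z] K by auto
    \<comment> \<open>Place \<open>w\<close> on the class \<open>P\<int>\<close>, below the shift of \<open>\<eta>\<close> that is one on this class.\<close>
    define y where "y n = (P dvd n \<and> w (n div P))" for n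
    have "y \<le> shift_power 1 (eta B)"
      using free by (auto simp: y_def shift_power_def eta_def le_fun_def algebra_simps elim!: dvdE)
    moreover have "shift_power 1 (eta B) \<in> ?X"
      unfolding orbit_closure_def by (rule closure_subset[THEN subsetD]) simp
    ultimately have "y \<in> hereditary_closure ?X" by (auto simp: hereditary_closure_def)
    moreover have "E \<phi> y (p * P) = \<phi> z 0" for \<phi>
    proof -
      have "(\<lambda>j. y (p * P + j * P)) = shift_power p w"
        using P by (simp add: y_def shift_power_def add.commute flip: distrib_right)
      then show ?thesis
        unfolding E_def classwise_def
        by (simp add: shift_power_commute[of "belt_map K \<phi>", OF belt_map_shift])
          (simp add: shift_power_def wp)
    qed
    ultimately show "\<exists>y\<in>hereditary_closure ?X. \<exists>p. \<forall>\<phi>. E \<phi> y p = \<phi> z 0" by blast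
  next
    show "E id y = y" for y
      by (simp add: E_def classwise_def belt_map_id)
  qed (simp_all add: E_def classwise_shift continuous_on_classwise continuous_on_belt_map)
qed

end
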